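(* Let $K$ be a field in which arithmetic operations and equality testing can be carried out effectively (e.g. $K=\mathbb{Q}$). There is an algorithm which, given as input an elliptic curve $E$ over $K$ by a Weierstrass equation $Y^2+a_1XY+a_3Y=X^3+a_2X^2+a_4X+a_6$ with $a_i\in K$, together with an $x$-arithmetic progression on $E$, i.e. elements $x_0,\dots,x_n\in K$ with $x_i=x_0+id$ ($d\neq 0$) such that for every $i$ there is a point of $E(K)$ with $X$-coordinate $x_i$, decides whether or not $E$ has a simultaneous arithmetic progression with support $x_0,\dots,x_n$; that is, whether there exist points $P_0,\dots,P_n\in E(K)$ with $X$-coordinate of $P_i$ equal to $x_i$ and a Weierstrass change of variables $X'=u^2X+s$, $Y'=u^3Y+rX+t$ ($u\in K^\*$, $r,s,t\in K$) such that the images $P_0',\dots,P_n'$ of $P_0,\dots,P_n$ form a simultaneous arithmetic progression on the transformed equation (in which case the algorithm also produces such a change of variables).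
   Context: Points $P_0=(x_0',y_0'),\dots,P_n=(x_n',y_n')$ on a given Weierstrass equation form a simultaneous arithmetic progression (s.a.p.) of length $n+1$ if (a) $x_0',\dots,x_n'$ is an arithmetic progression with nonzero common difference (its support), and (b) there is a permutation $\sigma$ of $\{0,\dots,n\}$ such that $y_{\sigma(0)}',\dots,y_{\sigma(n)}'$ is an arithmetic progression. Note that the property of being an $x$-arithmetic progression is preserved by Weierstrass changes of variables, whereas the $y$-condition depends on the chosen equation. *)

theory Defs
  imports Main "HOL-Library.Nat_Bijection" "HOL-Combinatorics.Permutations"
begin

datatype recf =
    Zero
  | Succ
  | Proj nat
  | Comp recf "recf list"
  | PrimRec recf recf
  | Mu recf

text \<open>\<open>computes f xs y\<close>: the program \<open>f\<close> halts on the arguments \<open>xs\<close> with result \<open>y\<close>.\<close>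

inductive computes :: "recf \<Rightarrow> nat list \<Rightarrow> nat \<Rightarrow> bool" where
  Zero: "computes Zero xs 0"
| Succ: "computes Succ [x] (Suc x)"
| Proj: "i < length xs \<Longrightarrow> computes (Proj i) xs (xs ! i)"
| Comp: "\<lbrakk>list_all2 (\<lambda>g y. computes g xs y) gs ys; computes f ys z\<rbrakk>
         \<Longrightarrow> computes (Comp f gs) xs z"
| PrimRec_0: "computes g xs y \<Longrightarrow> computes (PrimRec g h) (0 # xs) y"
| PrimRec_Suc: "\<lbrakk>computes (PrimRec g h) (n # xs) y; computes h (n # y # xs) z\<rbrakk>
         \<Longrightarrow> computes (PrimRec g h) (Suc n # xs) z"
| Mu: "\<lbrakk>computes f (n # xs) 0; \<forall>m<n. \<exists>k. computes f (m # xs) (Suc k)\<rbrakk>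
         \<Longrightarrow> computes (Mu f) xs n"

inductive_cases computes_ZeroE: "computes Zero xs y"
inductive_cases computes_SuccE: "computes Succ xs y"
inductive_cases computes_ProjE: "computes (Proj i) xs y"
inductive_cases computes_CompE: "computes (Comp f gs) xs y"
inductive_cases computes_PrimRec_0E: "computes (PrimRec g h) (0 # xs) y"
inductive_cases computes_PrimRec_SucE: "computes (PrimRec g h) (Suc n # xs) y"
inductive_cases computes_MuE: "computes (Mu f) xs y"

lemma computes_deterministic: "computes f xs y \<Longrightarrow> computes f xs y' \<Longrightarrow> y = y'"
proof (induction f xs y arbitrary: y' rule: computes.induct)
  case (Zero xs)
  then show ?case by (rule computes_ZeroE) simp
next
  case (Succ x)
  then show ?case by (rule computes_SuccE) simp
next
  case (Proj i xs)
  from Proj.prems show ?case by (rule computes_ProjE) simp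
next
  case (Comp xs gs ys f z)
  from Comp.prems obtain ys'
    where ys': "list_all2 (\<lambda>g y. computes g xs y) gs ys'" and z: "computes f ys' y'"
    by (rule computes_CompE)
  have "ys = ys'"
  proof (rule nth_equalityI)
    show "length ys = length ys'"
      using Comp.IH(1) ys' by (simp add: list_all2_conv_all_nth)
    show "ys ! i = ys' ! i" if "i < length ys" for i
      using Comp.IH(1) ys' that unfolding list_all2_conv_all_nth by metis
  qed
  with Comp.IH(2) z show ?case by blast
next
  case (PrimRec_0 g xs y h)
  from PrimRec_0.prems show ?case
    by (rule computes_PrimRec_0E) (rule PrimRec_0.IH)
next
  case (PrimRec_Suc g h n xs y z)
  from PrimRec_Suc.prems show ?case
    by (rule computes_PrimRec_SucE) (use PrimRec_Suc.IH in blast)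
next
  case (Mu f n xs)
  from Mu.prems have *: "computes f (y' # xs) 0" "\<forall>m<y'. \<exists>k. computes f (m # xs) (Suc k)"
    by (auto elim: computes_MuE)
  show ?case
  proof (cases n y' rule: linorder_cases)
    case less
    with * Mu.IH(1) show ?thesis by (metis nat.distinct(1))
  next
    case greater
    with * Mu.IH(2) show ?thesis by (metis nat.distinct(1))
  qed
qed

text \<open>
  A constructive field in the sense of Mal'cev: elements are named by natural numbers
  (an element may have several names), and arithmetic and equality of named elements
  are recursive.  Every field whose elements are represented by a recursive set of
  codes with recursive operations and equality is of this form, after sending the
  non-codes to some fixed element.
\<close>

definition effective_field :: "(nat \<Rightarrow> 'k::field) \<Rightarrow> bool" where
  "effective_field \<nu> \<longleftrightarrow>
     surj \<nu> \<and>
     (\<exists>f. \<forall>a b. \<exists>c. computes f [a, b] c \<and> \<nu> c = \<nu> a + \<nu> b) \<and>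
     (\<exists>f. \<forall>a b. \<exists>c. computes f [a, b] c \<and> \<nu> c = \<nu> a - \<nu> b) \<and>
     (\<exists>f. \<forall>a b. \<exists>c. computes f [a, b] c \<and> \<nu> c = \<nu> a * \<nu> b) \<and>
     (\<exists>f. \<forall>a b. \<nu> b \<noteq> 0 \<longrightarrow> (\<exists>c. computes f [a, b] c \<and> \<nu> c = \<nu> a / \<nu> b)) \<and>
     (\<exists>f. \<forall>a b. computes f [a, b] (if \<nu> a = \<nu> b then 1 else 0))"

record 'k weierstrass =
  a1 :: 'k
  a2 :: 'k
  a3 :: 'k
  a4 :: 'k
  a6 :: 'k

definition on_curve :: "'k::field weierstrass \<Rightarrow> 'k \<times> 'k \<Rightarrow> bool" where
  "on_curve E P \<longleftrightarrow> (case P of (x, y) \<Rightarrow>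
     y^2 + a1 E * x * y + a3 E * y = x^3 + a2 E * x^2 + a4 E * x + a6 E)"

definition discriminant :: "'k::field weierstrass \<Rightarrow> 'k" where
  "discriminant E =
    (let b2 = a1 E ^ 2 + 4 * a2 E;
         b4 = 2 * a4 E + a1 E * a3 E;
         b6 = a3 E ^ 2 + 4 * a6 E;
         b8 = a1 E ^ 2 * a6 E + 4 * a2 E * a6 E - a1 E * a3 E * a4 E
              + a2 E * a3 E ^ 2 - a4 E ^ 2
     in - (b2 ^ 2) * b8 - 8 * b4 ^ 3 - 27 * b6 ^ 2 + 9 * b2 * b4 * b6)"

definition elliptic_curve :: "'k::field weierstrass \<Rightarrow> bool" where
  "elliptic_curve E \<longleftrightarrow> discriminant E \<noteq> 0"

definition change_point :: "'k::field \<Rightarrow> 'k \<Rightarrow> 'k \<Rightarrow> 'k \<Rightarrow> 'k \<times> 'k \<Rightarrow> 'k \<times> 'k" where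
  "change_point u r s t P = (case P of (x, y) \<Rightarrow> (u^2 * x + s, u^3 * y + r * x + t))"

text \<open>
  The equation satisfied by \<open>(X', Y')\<close>, obtained by substituting \<open>X = (X' - s) / u\<^sup>2\<close> and
  \<open>Y = (Y' - p * X' - q) / u\<^sup>3\<close> and clearing \<open>u\<^sup>6\<close>; see \<open>on_curve_change_point\<close>.
\<close>

definition change_curve ::
  "'k::field \<Rightarrow> 'k \<Rightarrow> 'k \<Rightarrow> 'k \<Rightarrow> 'k weierstrass \<Rightarrow> 'k weierstrass" where
  "change_curve u r s t E =
    (let p = r / u^2; q = t - r * s / u^2 in
     \<lparr> a1 = u * a1 E - 2 * p,
       a2 = u^2 * a2 E - 3 * s - p^2 + u * a1 E * p,
       a3 = u^3 * a3 E - u * s * a1 E - 2 * q,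
       a4 = u^4 * a4 E - 2 * u^2 * s * a2 E + 3 * s^2 - 2 * p * q + u * a1 E * q
            - u * s * a1 E * p + u^3 * a3 E * p,
       a6 = u^6 * a6 E - u^4 * s * a4 E + u^2 * s^2 * a2 E - s^3 - q^2
            - u * s * a1 E * q + u^3 * a3 E * q \<rparr>)"

lemma on_curve_change_point:
  fixes u :: "'k::field"
  assumes "u \<noteq> 0"
  shows "on_curve (change_curve u r s t E) (change_point u r s t P) \<longleftrightarrow> on_curve E P"
proof -
  obtain x y where P: "P = (x, y)" by force
  have identity:
    "((u^3 * y + p * u^2 * x + (q + p * s))^2
       + (u * A1 - 2 * p) * (u^2 * x + s) * (u^3 * y + p * u^2 * x + (q + p * s))
       + (u^3 * A3 - u * s * A1 - 2 * q) * (u^3 * y + p * u^2 * x + (q + p * s)))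
     - ((u^2 * x + s)^3 + (u^2 * A2 - 3 * s - p^2 + u * A1 * p) * (u^2 * x + s)^2
       + (u^4 * A4 - 2 * u^2 * s * A2 + 3 * s^2 - 2 * p * q + u * A1 * q
          - u * s * A1 * p + u^3 * A3 * p) * (u^2 * x + s)
       + (u^6 * A6 - u^4 * s * A4 + u^2 * s^2 * A2 - s^3 - q^2
          - u * s * A1 * q + u^3 * A3 * q))
     = u^6 * ((y^2 + A1 * x * y + A3 * y) - (x^3 + A2 * x^2 + A4 * x + A6))"
    for A1 A2 A3 A4 A6 p q :: 'k
    by algebra
  define p where "p = r / u^2"
  define q where "q = t - r * s / u^2"
  have r: "r = p * u^2" using assms by (simp add: p_def)
  have t: "t = q + p * s" by (simp add: q_def p_def)
  have "on_curve (change_curve u r s t E) (change_point u r s t P) \<longleftrightarrow>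
    u^6 * ((y^2 + a1 E * x * y + a3 E * y) - (x^3 + a2 E * x^2 + a4 E * x + a6 E)) = 0"
    unfolding identity[of p q "a1 E" "a3 E" "a2 E" "a4 E" "a6 E", symmetric]
    unfolding on_curve_def change_curve_def change_point_def P Let_def
      p_def[symmetric] q_def[symmetric]
    by (simp only: r[symmetric] t[symmetric] weierstrass.simps prod.case
          right_minus_eq)
  also have "\<dots> \<longleftrightarrow> on_curve E P"
    using assms by (simp add: on_curve_def P)
  finally show ?thesis .
qed

definition arith_prog :: "'k::field list \<Rightarrow> 'k \<Rightarrow> bool" where
  "arith_prog zs d \<longleftrightarrow> zs \<noteq> [] \<and> (\<forall>i<length zs. zs ! i = zs ! 0 + of_nat i * d)"

definition x_arith_prog :: "'k::field weierstrass \<Rightarrow> 'k list \<Rightarrow> bool" where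
  "x_arith_prog E xs \<longleftrightarrow>
     (\<exists>d. d \<noteq> 0 \<and> arith_prog xs d) \<and> (\<forall>x\<in>set xs. \<exists>y. on_curve E (x, y))"

definition simultaneous_arith_prog :: "'k::field weierstrass \<Rightarrow> ('k \<times> 'k) list \<Rightarrow> bool" where
  "simultaneous_arith_prog E Ps \<longleftrightarrow>
     (\<forall>P\<in>set Ps. on_curve E P) \<and>
     (\<exists>d. d \<noteq> 0 \<and> arith_prog (map fst Ps) d) \<and>
     (\<exists>\<sigma>. \<sigma> permutes {..<length Ps} \<and>
        (\<exists>e. arith_prog (map (\<lambda>i. snd (Ps ! \<sigma> i)) [0..<length Ps]) e))"

definition sap_after_change ::
  "'k::field weierstrass \<Rightarrow> 'k list \<Rightarrow> 'k \<Rightarrow> 'k \<Rightarrow> 'k \<Rightarrow> 'k \<Rightarrow> bool" where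
  "sap_after_change E xs u r s t \<longleftrightarrow>
     u \<noteq> 0 \<and>
     (\<exists>Ps. map fst Ps = xs \<and> (\<forall>P\<in>set Ps. on_curve E P) \<and>
        simultaneous_arith_prog (change_curve u r s t E) (map (change_point u r s t) Ps))"

definition has_sap :: "'k::field weierstrass \<Rightarrow> 'k list \<Rightarrow> bool" where
  "has_sap E xs \<longleftrightarrow> (\<exists>u r s t. sap_after_change E xs u r s t)"

end

theory Submission imports Defs begin

text \<open>
  A permutation \<open>\<sigma>\<close> puts \<open>f 0, \<dots>, f (n - 1)\<close> into arithmetic progression iff the deviations
  \<open>f (\<sigma> k) - f (\<sigma> 0) - k (f (\<sigma> 1) - f (\<sigma> 0))\<close> vanish.  These are linear in \<open>f\<close>, so for fixed ordinates
  \<open>y\<close> and fixed \<open>\<sigma>\<close> the condition on the change of variables is \<open>u\<^sup>3 A k + r B k = 0\<close> for all \<open>k\<close>,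
  where \<open>A\<close>, \<open>B\<close> are the deviations of the ordinates and abscissae; \<open>s\<close> and \<open>t\<close> are irrelevant.
  If it is solvable, then it is solved by \<open>(u, r) = (1, 0)\<close> or by \<open>(B j, - (B j)\<^sup>2 A j)\<close> for some \<open>j\<close>.
  One ordinate above each abscissa is found by unbounded search, which terminates because points
  exist by hypothesis; the only other choice is its conjugate.  What remains is a finite search over
  permutations, choices of conjugates and pairs \<open>(u, r)\<close>.
\<close>

section \<open>Computable functions on the natural numbers\<close>

definition computable :: "(nat \<Rightarrow> nat) \<Rightarrow> bool" where
  "computable f \<longleftrightarrow> (\<exists>p. \<forall>x. computes p [x] (f x))"

definition computable2 :: "(nat \<Rightarrow> nat \<Rightarrow> nat) \<Rightarrow> bool" where
  "computable2 f \<longleftrightarrow> (\<exists>p. \<forall>a b. computes p [a, b] (f a b))"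

lemma computes_Proj: "i < length xs \<Longrightarrow> xs ! i = y \<Longrightarrow> computes (Proj i) xs y"
  using computes.Proj by metis

lemma computes_Comp1: "computes g xs y \<Longrightarrow> computes f [y] z \<Longrightarrow> computes (Comp f [g]) xs z"
  by (rule computes.Comp[where ys = "[y]"]) simp_all

lemma computes_Comp2:
  "computes g xs a \<Longrightarrow> computes h xs b \<Longrightarrow> computes f [a, b] z \<Longrightarrow> computes (Comp f [g, h]) xs z"
  by (rule computes.Comp[where ys = "[a, b]"]) simp_all

lemma computable_id: "computable (\<lambda>x. x)"
  unfolding computable_def by (rule exI[of _ "Proj 0"]) (auto intro: computes_Proj)

lemma computable_compose: "computable f \<Longrightarrow> computable g \<Longrightarrow> computable (\<lambda>x. f (g x))"
  unfolding computable_def by (meson computes_Comp1)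

lemma computable_compose2:
  "computable2 f \<Longrightarrow> computable g \<Longrightarrow> computable h \<Longrightarrow> computable (\<lambda>x. f (g x) (h x))"
  unfolding computable_def computable2_def by (meson computes_Comp2)

lemma computable2_fst: "computable2 (\<lambda>a b. a)"
  unfolding computable2_def by (rule exI[of _ "Proj 0"]) (auto intro: computes_Proj)

lemma computable2_snd: "computable2 (\<lambda>a b. b)"
  unfolding computable2_def by (rule exI[of _ "Proj 1"]) (auto intro: computes_Proj)

lemma computable2_compose: "computable f \<Longrightarrow> computable2 g \<Longrightarrow> computable2 (\<lambda>a b. f (g a b))"
  unfolding computable_def computable2_def by (meson computes_Comp1)

lemma computable2_compose2:
  "computable2 f \<Longrightarrow> computable2 g \<Longrightarrow> computable2 h \<Longrightarrow> computable2 (\<lambda>a b. f (g a b) (h a b))"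
  unfolding computable2_def by (meson computes_Comp2)

lemma computable_Suc: "computable f \<Longrightarrow> computable (\<lambda>x. Suc (f x))"
  by (rule computable_compose[of Suc]) (auto simp: computable_def intro: computes.Succ)

lemma computable_const: "computable (\<lambda>x. c)"
proof (induction c)
  case 0
  show ?case unfolding computable_def by (meson computes.Zero)
next
  case (Suc c)
  then show ?case by (rule computable_Suc)
qed

lemma computable2_Suc: "computable2 f \<Longrightarrow> computable2 (\<lambda>a b. Suc (f a b))"
  by (rule computable2_compose[of Suc, OF computable_Suc[OF computable_id]])

text \<open>Recursion without parameters comes first: it gives the predecessor and
  \<open>triangle\<close>, hence pairing and unpairing, on which \<open>computable_rec_nat\<close>
  relies for parameters.\<close>

lemma computable_rec_closed:
  assumes "computable2 h"
  shows "computable (rec_nat 0 h)"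
proof -
  obtain p where p: "\<And>a b. computes p [a, b] (h a b)"
    using assms unfolding computable2_def by blast
  have "computes (PrimRec Zero p) [n] (rec_nat 0 h n)" for n
    by (induction n) (auto intro: computes.PrimRec_0 computes.PrimRec_Suc computes.Zero p)
  then show ?thesis unfolding computable_def by blast
qed

lemma computable2_funpow:
  assumes "computable f"
  shows "computable2 (\<lambda>n x. (f ^^ n) x)"
proof -
  obtain p where p: "\<And>a. computes p [a] (f a)"
    using assms unfolding computable_def by blast
  have "computes (PrimRec (Proj 0) (Comp p [Proj 1])) [n, x] ((f ^^ n) x)" for n x
  proof (induction n)
    case 0
    show ?case by (auto intro!: computes.PrimRec_0 computes_Proj)
  next
    case (Suc n)
    have "computes (Comp p [Proj 1]) [n, (f ^^ n) x, x] ((f ^^ Suc n) x)"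
      by (auto intro!: computes_Comp1[OF computes_Proj] p)
    with Suc show ?case by (rule computes.PrimRec_Suc)
  qed
  then show ?thesis unfolding computable2_def by blast
qed

lemma computable_Least:
  assumes "computable2 f" and ex: "\<And>z. \<exists>n. f n z = 0"
  shows "computable (\<lambda>z. LEAST n. f n z = 0)"
proof -
  obtain p where p: "\<And>a b. computes p [a, b] (f a b)"
    using assms unfolding computable2_def by blast
  have "computes (Mu p) [z] (LEAST n. f n z = 0)" for z
  proof (rule computes.Mu)
    show "computes p [LEAST n. f n z = 0, z] 0"
      using p[of "LEAST n. f n z = 0" z] LeastI_ex[OF ex] by simp
    show "\<forall>m<LEAST n. f n z = 0. \<exists>k. computes p [m, z] (Suc k)"
      using p not_less_Least by (metis not0_implies_Suc)
  qed
  then show ?thesis unfolding computable_def by blast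
qed

lemma computable2_add: "computable2 (+)"
proof -
  have "(Suc ^^ n) x = n + x" for n x by (induction n) auto
  then show ?thesis using computable2_funpow[OF computable_Suc[OF computable_id]] by simp
qed

lemma computable2_diff: "computable2 (-)"
proof -
  \<comment> \<open>The recursion that returns its counter is the predecessor; iterating it gives
    truncated subtraction with the arguments exchanged, hence the swap at the end.\<close>
  have "rec_nat 0 (\<lambda>n _. n) = (\<lambda>n. n - 1)"
  proof
    show "rec_nat 0 (\<lambda>n _. n) n = n - 1" for n by (cases n) auto
  qed
  then have "computable (\<lambda>n. n - 1)"
    using computable_rec_closed[OF computable2_fst] by simp
  moreover have "((\<lambda>n. n - 1) ^^ n) x = x - n" for n x :: nat by (induction n) auto
  ultimately have "computable2 (\<lambda>n x. x - n)"
    using computable2_funpow[of "\<lambda>n. n - 1"] by simp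
  from computable2_compose2[OF this computable2_snd computable2_fst] show ?thesis by simp
qed

lemma computable_triangle: "computable triangle"
proof -
  have "rec_nat 0 (\<lambda>n y. y + Suc n) = triangle"
  proof
    show "rec_nat 0 (\<lambda>n y. y + Suc n) n = triangle n" for n by (induction n) auto
  qed
  moreover have "computable2 (\<lambda>n y. y + Suc n)"
    by (intro computable2_compose2[OF computable2_add] computable2_Suc computable2_fst computable2_snd)
  ultimately show ?thesis using computable_rec_closed by fastforce
qed

lemma computable2_pair: "computable2 (\<lambda>a b. prod_encode (a, b))"
  unfolding prod_encode_def prod.case
  by (intro computable2_compose2[OF computable2_add] computable2_compose[OF computable_triangle]
      computable2_fst computable2_snd)

section \<open>Inverting Cantor pairing; recursion with parameters\<close>

definition pfst :: "nat \<Rightarrow> nat" where "pfst z = fst (prod_decode z)"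
definition psnd :: "nat \<Rightarrow> nat" where "psnd z = snd (prod_decode z)"

lemma pfst_prod_encode [simp]: "pfst (prod_encode (a, b)) = a"
  and psnd_prod_encode [simp]: "psnd (prod_encode (a, b)) = b"
  by (simp_all add: pfst_def psnd_def)

lemma computable_pfst_psnd_closed: "computable pfst \<and> computable psnd"
proof -
  \<comment> \<open>Cantor pairing is \<open>prod_encode (a, b) = triangle (a + b) + a\<close>, so
    \<open>a + b\<close> is the least \<open>s\<close> with \<open>z < triangle (Suc s)\<close>;
    truncated subtraction turns this into an equation with \<open>0\<close>. Then \<open>a\<close>
    and \<open>b\<close> follow by subtraction.\<close>
  define diagonal where "diagonal z = (LEAST s. Suc z - triangle (Suc s) = 0)" for z
  have mono: "triangle a \<le> triangle b" if "a \<le> b" for a b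
    using that by (induction rule: dec_induct) auto
  have diagonal: "diagonal (prod_encode (a, b)) = a + b" for a b
    unfolding diagonal_def
  proof (rule Least_equality)
    show "Suc (prod_encode (a, b)) - triangle (Suc (a + b)) = 0"
      by (simp add: prod_encode_def)
    show "a + b \<le> s" if "Suc (prod_encode (a, b)) - triangle (Suc s) = 0" for s
    proof (rule ccontr)
      assume "\<not> a + b \<le> s"
      then have "triangle (Suc s) \<le> triangle (a + b)" by (intro mono) simp
      with that show False by (simp add: prod_encode_def)
    qed
  qed
  have "computable diagonal"
    unfolding diagonal_def
  proof (rule computable_Least)
    show "computable2 (\<lambda>s z. Suc z - triangle (Suc s))"
      by (intro computable2_compose2[OF computable2_diff] computable2_compose[OF computable_triangle]
          computable2_Suc computable2_fst computable2_snd)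
    show "\<exists>n. Suc z - triangle (Suc n) = 0" for z by (rule exI[of _ z]) simp
  qed
  moreover have "pfst = (\<lambda>z. z - triangle (diagonal z))"
  proof
    fix z
    obtain a b where z: "z = prod_encode (a, b)" by (metis prod_decode_inverse surj_pair)
    show "pfst z = z - triangle (diagonal z)"
      unfolding z diagonal pfst_prod_encode by (simp add: prod_encode_def)
  qed
  moreover have "computable (\<lambda>z. z - triangle (diagonal z))"
    by (intro computable_compose2[OF computable2_diff] computable_compose[OF computable_triangle]
        computable_id \<open>computable diagonal\<close>)
  ultimately have 1: "computable pfst" by simp
  have "psnd = (\<lambda>z. diagonal z - pfst z)"
  proof
    fix z
    obtain a b where z: "z = prod_encode (a, b)" by (metis prod_decode_inverse surj_pair)
    show "psnd z = diagonal z - pfst z" unfolding z diagonal by simp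
  qed
  moreover have "computable (\<lambda>z. diagonal z - pfst z)"
    by (rule computable_compose2[OF computable2_diff \<open>computable diagonal\<close> 1])
  ultimately show ?thesis using 1 by simp
qed

lemmas computable_add = computable_compose2[OF computable2_add]
lemmas computable_diff = computable_compose2[OF computable2_diff]
lemmas computable_pair = computable_compose2[OF computable2_pair]
lemmas computable_pfst = computable_compose[OF conjunct1[OF computable_pfst_psnd_closed]]
lemmas computable_psnd = computable_compose[OF conjunct2[OF computable_pfst_psnd_closed]]

lemma computable_uncurried:
  assumes "computable (\<lambda>z. f (pfst z) (psnd z))"
  shows "computable2 f"
proof -
  have "computable2 (\<lambda>a b. f (pfst (prod_encode (a, b))) (psnd (prod_encode (a, b))))"
    by (rule computable2_compose[OF assms computable2_pair])
  then show ?thesis by simp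
qed

text \<open>
  A bound variable is added to the environment by pairing, so the premise for the body of a binder
  has the environment in \<open>pfst z\<close> and the bound variables in \<open>psnd z\<close>.
\<close>

lemma computable_rec_nat:
  assumes "computable (\<lambda>z. h (pfst z) (pfst (psnd z)) (psnd (psnd z)))"
    and "computable b" and "computable n"
  shows "computable (\<lambda>x. rec_nat (b x) (h x) (n x))"
proof -
  obtain p where p: "\<And>z. computes p [z] (h (pfst z) (pfst (psnd z)) (psnd (psnd z)))"
    using assms(1) unfolding computable_def by blast
  obtain q where q: "\<And>x. computes q [x] (b x)"
    using assms(2) unfolding computable_def by blast
  obtain pr where pr: "\<And>a b. computes pr [a, b] (prod_encode (a, b))"
    using computable2_pair unfolding computable2_def by blast
  \<comment> \<open>\<open>PrimRec\<close> hands over counter, accumulator and parameter in this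
    order; \<open>step\<close> regroups them as the parameter paired with the two bound
    variables.\<close>
  define step where "step = Comp p [Comp pr [Proj 2, Comp pr [Proj 0, Proj 1]]]"
  have step: "computes step [k, y, x] (h x k y)" for k y x
  proof -
    have "computes (Comp pr [Proj 0, Proj 1]) [k, y, x] (prod_encode (k, y))"
      by (rule computes_Comp2[OF _ _ pr]) (auto intro: computes_Proj)
    then have "computes (Comp pr [Proj 2, Comp pr [Proj 0, Proj 1]]) [k, y, x]
        (prod_encode (x, prod_encode (k, y)))"
      by (intro computes_Comp2[OF _ _ pr]) (auto intro: computes_Proj)
    then show ?thesis
      unfolding step_def using computes_Comp1 p by fastforce
  qed
  have "computes (PrimRec q step) [k, x] (rec_nat (b x) (h x) k)" for k x
    by (induction k) (auto intro: computes.PrimRec_0 computes.PrimRec_Suc q step)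
  then have "computable2 (\<lambda>k x. rec_nat (b x) (h x) k)"
    unfolding computable2_def by blast
  from computable_compose2[OF this assms(3) computable_id] show ?thesis .
qed

section \<open>Decidable predicates, bounded quantifiers and bounded search\<close>

definition decidable :: "(nat \<Rightarrow> bool) \<Rightarrow> bool" where
  "decidable P \<longleftrightarrow> computable (\<lambda>x. of_bool (P x))"

text \<open>Recursion over the truth value: no step yields \<open>g x\<close>, one step yields
  \<open>f x\<close>.\<close>

lemma computable_If:
  assumes "decidable P" and "computable f" and "computable g"
  shows "computable (\<lambda>x. if P x then f x else g x)"
proof -
  have "computable (\<lambda>x. rec_nat (g x) (\<lambda>_ _. f x) (of_bool (P x)))"
    using assms unfolding decidable_def
    by (intro computable_rec_nat computable_compose[OF assms(2)] computable_pfst computable_id)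
  also have "(\<lambda>x. rec_nat (g x) (\<lambda>_ _. f x) (of_bool (P x))) = (\<lambda>x. if P x then f x else g x)"
    by auto
  finally show ?thesis .
qed

lemma decidable_not:
  assumes "decidable P"
  shows "decidable (\<lambda>x. \<not> P x)"
proof -
  have "computable (\<lambda>x. if P x then 0 else 1)"
    by (intro computable_If assms computable_const)
  also have "(\<lambda>x. if P x then 0 else 1) = (\<lambda>x. of_bool (\<not> P x))" by auto
  finally show ?thesis unfolding decidable_def .
qed

lemma decidable_conj:
  assumes "decidable P" and "decidable Q"
  shows "decidable (\<lambda>x. P x \<and> Q x)"
proof -
  have "computable (\<lambda>x. if P x then of_bool (Q x) else 0)"
    using assms(2) unfolding decidable_def[of Q] by (intro computable_If assms(1) computable_const)
  also have "(\<lambda>x. if P x then of_bool (Q x) else 0) = (\<lambda>x. of_bool (P x \<and> Q x))" by auto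
  finally show ?thesis unfolding decidable_def .
qed

lemma decidable_compose: "decidable P \<Longrightarrow> computable f \<Longrightarrow> decidable (\<lambda>x. P (f x))"
  unfolding decidable_def by (rule computable_compose)

text \<open>Adapts a predicate of the counter alone to the environment of
  \<open>computable_rec_nat\<close>, which binds the pair of counter and accumulator.\<close>

lemma decidable_forget_accumulator:
  assumes "decidable (\<lambda>z. P (pfst z) (psnd z))"
  shows "decidable (\<lambda>z. P (pfst z) (pfst (psnd z)))"
proof -
  have "computable (\<lambda>z. prod_encode (pfst z, pfst (psnd z)))"
    by (intro computable_pair computable_pfst computable_psnd computable_id)
  from decidable_compose[OF assms this] show ?thesis by simp
qed

lemma decidable_less:
  assumes "computable f" and "computable g"
  shows "decidable (\<lambda>x. f x < g x)"
proof -
  have "computable (\<lambda>x. rec_nat 0 (\<lambda>_ _. 1) (g x - f x))"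
    by (intro computable_rec_nat computable_const computable_diff assms)
  also have "(\<lambda>x. rec_nat 0 (\<lambda>_ _. 1) (g x - f x)) = (\<lambda>x. of_bool (f x < g x))"
  proof
    show "rec_nat 0 (\<lambda>_ _. 1) (g x - f x) = of_bool (f x < g x)" for x
      by (cases "g x - f x") auto
  qed
  finally show ?thesis unfolding decidable_def .
qed

lemma decidable_eq:
  assumes "computable f" and "computable g"
  shows "decidable (\<lambda>x. f x = g x)"
proof -
  have "decidable (\<lambda>x. \<not> f x < g x \<and> \<not> g x < f x)"
    by (intro decidable_conj decidable_not decidable_less assms)
  also have "(\<lambda>x. \<not> f x < g x \<and> \<not> g x < f x) = (\<lambda>x. f x = g x)" by auto
  finally show ?thesis .
qed

lemma decidable_all_less:
  assumes "decidable (\<lambda>z. P (pfst z) (psnd z))" and "computable n"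
  shows "decidable (\<lambda>x. \<forall>k<n x. P x k)"
proof -
  note P = decidable_forget_accumulator[of P, OF assms(1)]
  have "computable (\<lambda>x. rec_nat 1 (\<lambda>k y. if P x k then y else 0) (n x))"
    by (intro computable_rec_nat computable_If P computable_const computable_psnd computable_id assms)
  moreover have "rec_nat (Suc 0) (\<lambda>k y. if P x k then y else 0) m = of_bool (\<forall>k<m. P x k)"
    for x m
    by (induction m) (auto simp: less_Suc_eq)
  ultimately show ?thesis unfolding decidable_def by simp
qed

text \<open>The value \<open>0\<close> means that the search failed; a witness \<open>k\<close> is returned as \<open>Suc k\<close>.\<close>

definition bsearch :: "(nat \<Rightarrow> bool) \<Rightarrow> nat \<Rightarrow> nat" where
  "bsearch P = rec_nat 0 (\<lambda>k y. if y = 0 then if P k then Suc k else 0 else y)"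

lemma bsearch_eq_0: "bsearch P n = 0 \<longleftrightarrow> (\<forall>k<n. \<not> P k)"
  unfolding bsearch_def by (induction n) (auto simp: less_Suc_eq)

lemma bsearch_eq_Suc: "bsearch P n = Suc k \<Longrightarrow> P k"
  unfolding bsearch_def by (induction n) (auto split: if_splits)

lemma computable_bsearch:
  assumes "decidable (\<lambda>z. P (pfst z) (psnd z))" and "computable n"
  shows "computable (\<lambda>x. bsearch (P x) (n x))"
proof -
  note P = decidable_forget_accumulator[of P, OF assms(1)]
  show ?thesis
    unfolding bsearch_def
    by (intro computable_rec_nat computable_If P decidable_eq computable_const computable_Suc
        computable_pfst computable_psnd computable_id assms)
qed

section \<open>Lists coded by iterated pairing\<close>

definition ctl :: "nat \<Rightarrow> nat" where "ctl c = psnd (c - 1)"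

definition cdrop :: "nat \<Rightarrow> nat \<Rightarrow> nat" where "cdrop k c = rec_nat c (\<lambda>_. ctl) k"

definition cnth :: "nat \<Rightarrow> nat \<Rightarrow> nat" where "cnth c k = pfst (cdrop k c - 1)"

text \<open>The code bounds the length (\<open>length_le_list_encode\<close>), so it serves as the
  number of rounds; a round counts when the remaining list has a nonzero code, that is, is
  nonempty.\<close>

definition clength :: "nat \<Rightarrow> nat" where
  "clength c = rec_nat 0 (\<lambda>k n. if cdrop k c = 0 then n else Suc n) c"

lemma ctl_list_encode: "ctl (list_encode xs) = list_encode (tl xs)"
proof (cases xs)
  case Nil
  have "prod_encode (0, 0) = 0" by (simp add: prod_encode_def)
  then have "psnd 0 = 0" by (metis psnd_prod_encode)
  with Nil show ?thesis by (simp add: ctl_def)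
qed (simp add: ctl_def)

lemma cdrop_list_encode: "cdrop k (list_encode xs) = list_encode (drop k xs)"
  unfolding cdrop_def by (induction k) (simp_all add: ctl_list_encode drop_Suc tl_drop)

lemma cnth_list_encode: "k < length xs \<Longrightarrow> cnth (list_encode xs) k = xs ! k"
  unfolding cnth_def cdrop_list_encode by (simp flip: Cons_nth_drop_Suc)

lemma length_le_list_encode: "length xs \<le> list_encode xs"
  by (induction xs) (auto intro: le_trans[OF _ le_prod_encode_2])

lemma clength_list_encode: "clength (list_encode xs) = length xs"
proof -
  have eq_0: "list_encode ys = 0 \<longleftrightarrow> ys = []" for ys by (cases ys) auto
  have "rec_nat 0 (\<lambda>k n. if cdrop k (list_encode xs) = 0 then n else Suc n) m = min m (length xs)" for m
    by (induction m) (auto simp: cdrop_list_encode eq_0)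
  then show ?thesis unfolding clength_def using length_le_list_encode[of xs] by simp
qed

text \<open>\<open>prod_encode\<close> is monotone because \<open>triangle\<close> is. This bounds
  the codes of all lists of a given length with bounded entries, which makes the search for
  candidates finite.\<close>

lemma list_encode_mono: "list_all2 (\<le>) xs ys \<Longrightarrow> list_encode xs \<le> list_encode ys"
proof (induction rule: list_all2_induct)
  case (Cons x xs y ys)
  have "triangle a \<le> triangle b" if "a \<le> b" for a b
    using that by (induction rule: dec_induct) auto
  with Cons show ?case by (simp add: prod_encode_def add_mono)
qed simp

lemma computable_cdrop: "computable k \<Longrightarrow> computable c \<Longrightarrow> computable (\<lambda>x. cdrop (k x) (c x))"
  unfolding cdrop_def ctl_def
  by (intro computable_rec_nat computable_psnd computable_diff computable_const computable_id)

lemma computable_cnth: "computable c \<Longrightarrow> computable k \<Longrightarrow> computable (\<lambda>x. cnth (c x) (k x))"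
  unfolding cnth_def
  by (intro computable_pfst computable_diff computable_cdrop computable_const)

lemma computable_clength:
  assumes "computable c"
  shows "computable (\<lambda>x. clength (c x))"
proof (rule computable_compose[OF _ assms])
  show "computable clength"
    unfolding clength_def
    by (intro computable_rec_nat computable_If decidable_eq computable_cdrop computable_const
        computable_Suc computable_pfst computable_psnd computable_id)
qed

lemmas computable_intros =
  computable_id computable_const computable_Suc computable_add computable_diff computable_pair
  computable_pfst computable_psnd computable_If decidable_not decidable_conj decidable_less
  decidable_eq decidable_all_less computable_bsearch computable_cnth computable_clength

section \<open>The linear system for the change of variables\<close>

definition deviation :: "(nat \<Rightarrow> 'k::field) \<Rightarrow> (nat \<Rightarrow> nat) \<Rightarrow> nat \<Rightarrow> 'k" where
  "deviation f \<sigma> k = f (\<sigma> k) - f (\<sigma> 0) - of_nat k * (f (\<sigma> 1) - f (\<sigma> 0))"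

text \<open>The index \<open>1\<close> may be out of range when \<open>n = 1\<close>, but then
  \<open>k = 0\<close> and its term has the factor \<open>0\<close>; for \<open>k > 0\<close> the
  indices \<open>0\<close>, \<open>1\<close> and \<open>k\<close> are all below
  \<open>n\<close>.\<close>

lemma deviation_cong:
  assumes "k < n" and "\<And>j. j < n \<Longrightarrow> f (\<sigma> j) = g (\<tau> j)"
  shows "deviation f \<sigma> k = deviation g \<tau> k"
  using assms by (cases k) (simp_all add: deviation_def)

lemma deviation_affine:
  "deviation (\<lambda>i. v * f i + r * g i + t) \<sigma> k = v * deviation f \<sigma> k + r * deviation g \<sigma> k"
  by (simp add: deviation_def algebra_simps)

text \<open>Two or more terms force the common difference to be that of the first two; a single term
  is a progression for every difference, and its deviation at \<open>0\<close> vanishes.\<close>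

lemma arith_prog_iff_deviation:
  assumes "0 < n"
  shows "(\<exists>e. arith_prog (map (\<lambda>k. f (\<sigma> k)) [0..<n]) e) \<longleftrightarrow> (\<forall>k<n. deviation f \<sigma> k = 0)"
proof
  assume "\<exists>e. arith_prog (map (\<lambda>k. f (\<sigma> k)) [0..<n]) e"
  then obtain e where e: "f (\<sigma> k) = f (\<sigma> 0) + of_nat k * e" if "k < n" for k
    using assms by (auto simp: arith_prog_def)
  show "\<forall>k<n. deviation f \<sigma> k = 0"
  proof (intro allI impI)
    fix k assume "k < n"
    then show "deviation f \<sigma> k = 0"
      using e[of k] e[of 1] by (cases k) (simp_all add: deviation_def)
  qed
next
  assume "\<forall>k<n. deviation f \<sigma> k = 0"
  then have "arith_prog (map (\<lambda>k. f (\<sigma> k)) [0..<n]) (f (\<sigma> 1) - f (\<sigma> 0))"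
    using assms by (auto simp: arith_prog_def deviation_def algebra_simps)
  then show "\<exists>e. arith_prog (map (\<lambda>k. f (\<sigma> k)) [0..<n]) e" ..
qed

text \<open>The change of variables respects incidence with the curve and turns the difference
  \<open>d\<close> of the abscissae into \<open>u^2 * d\<close>, which is nonzero. Only the
  ordinates are left; the new ones are affine in the old coordinates, so their condition is linear
  in \<open>(u^3, r)\<close> and free of \<open>t\<close>.\<close>

lemma sap_after_change_iff:
  fixes E :: "'k::field weierstrass"
  assumes ap: "x_arith_prog E xs"
  shows "sap_after_change E xs u r s t \<longleftrightarrow> u \<noteq> 0 \<and>
    (\<exists>Y \<sigma>. (\<forall>i<length xs. on_curve E (xs ! i, Y i)) \<and> \<sigma> permutes {..<length xs} \<and>
      (\<forall>k<length xs. u^3 * deviation Y \<sigma> k + r * deviation ((!) xs) \<sigma> k = 0))"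
proof -
  define n where "n = length xs"
  obtain d where d: "d \<noteq> 0" "arith_prog xs d"
    using ap unfolding x_arith_prog_def by blast
  then have n: "0 < n" by (simp add: arith_prog_def n_def)
  have y_prog: "(\<exists>e. arith_prog (map (\<lambda>i. snd (map (change_point u r s t) Ps ! \<sigma> i))
        [0..<length (map (change_point u r s t) Ps)]) e)
      \<longleftrightarrow> (\<forall>k<n. u^3 * deviation (\<lambda>i. snd (Ps ! i)) \<sigma> k + r * deviation ((!) xs) \<sigma> k = 0)"
    if Ps: "map fst Ps = xs" and \<sigma>: "\<sigma> permutes {..<n}" for Ps \<sigma>
  proof -
    have len: "length Ps = n" using Ps n_def by auto
    have "map (\<lambda>i. snd (map (change_point u r s t) Ps ! \<sigma> i)) [0..<n]
        = map (\<lambda>k. (\<lambda>i. u^3 * snd (Ps ! i) + r * (xs ! i) + t) (\<sigma> k)) [0..<n]"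
    proof (rule map_cong[OF refl])
      fix k assume "k \<in> set [0..<n]"
      then have "\<sigma> k < n" using permutes_in_image[OF \<sigma>, of k] by simp
      then show "snd (map (change_point u r s t) Ps ! \<sigma> k)
          = (\<lambda>i. u^3 * snd (Ps ! i) + r * (xs ! i) + t) (\<sigma> k)"
        by (simp add: len flip: Ps) (simp add: change_point_def split: prod.split)
    qed
    then show ?thesis
      using arith_prog_iff_deviation[OF n, of "\<lambda>i. u^3 * snd (Ps ! i) + r * (xs ! i) + t" \<sigma>]
      unfolding length_map len deviation_affine by (simp only:)
  qed
  have x_prog: "\<exists>d. d \<noteq> 0 \<and> arith_prog (map fst (map (change_point u r s t) Ps)) d"
    if "map fst Ps = xs" "u \<noteq> 0" for Ps
  proof (intro exI conjI)
    show "u^2 * d \<noteq> 0" using d that by simp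
    have "map fst (map (change_point u r s t) Ps) = map (\<lambda>x. u^2 * x + s) xs"
      unfolding that(1)[symmetric] by (simp add: change_point_def split: prod.split)
    moreover have "arith_prog (map (\<lambda>x. u^2 * x + s) xs) (u^2 * d)"
      unfolding arith_prog_def
    proof (intro conjI allI impI)
      show "map (\<lambda>x. u^2 * x + s) xs \<noteq> []" using d by (simp add: arith_prog_def)
      fix i assume "i < length (map (\<lambda>x. u^2 * x + s) xs)"
      then have i: "i < length xs" "0 < length xs" by auto
      then have "xs ! i = xs ! 0 + of_nat i * d" using d unfolding arith_prog_def by blast
      then show "map (\<lambda>x. u^2 * x + s) xs ! i = map (\<lambda>x. u^2 * x + s) xs ! 0 + of_nat i * (u^2 * d)"
        by (simp only: nth_map i) (simp add: algebra_simps)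
    qed
    ultimately show "arith_prog (map fst (map (change_point u r s t) Ps)) (u^2 * d)" by simp
  qed
  show ?thesis
    unfolding n_def[symmetric]
  proof (intro iffI conjI; (elim conjE exE)?)
    assume "sap_after_change E xs u r s t"
    then obtain Ps \<sigma> where u: "u \<noteq> 0" and Ps: "map fst Ps = xs" "\<forall>P\<in>set Ps. on_curve E P"
      and \<sigma>: "\<sigma> permutes {..<length Ps}"
      and e: "\<exists>e. arith_prog (map (\<lambda>i. snd (map (change_point u r s t) Ps ! \<sigma> i))
        [0..<length (map (change_point u r s t) Ps)]) e"
      unfolding sap_after_change_def simultaneous_arith_prog_def by auto
    show "u \<noteq> 0" by (rule u)
    have len: "length Ps = n" using Ps n_def by auto
    have "on_curve E (xs ! i, snd (Ps ! i))" if "i < n" for i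
      using Ps that len by auto
    moreover have "\<forall>k<n. u^3 * deviation (\<lambda>i. snd (Ps ! i)) \<sigma> k + r * deviation ((!) xs) \<sigma> k = 0"
      using y_prog[OF Ps(1)] \<sigma> e len by simp
    ultimately show "\<exists>Y \<sigma>. (\<forall>i<n. on_curve E (xs ! i, Y i)) \<and> \<sigma> permutes {..<n} \<and>
        (\<forall>k<n. u^3 * deviation Y \<sigma> k + r * deviation ((!) xs) \<sigma> k = 0)"
      using \<sigma> len by (intro exI[of _ "\<lambda>i. snd (Ps ! i)"] exI[of _ \<sigma>]) simp
  next
    fix Y \<sigma>
    assume u: "u \<noteq> 0" and Y: "\<forall>i<n. on_curve E (xs ! i, Y i)" and \<sigma>: "\<sigma> permutes {..<n}"
      and dev: "\<forall>k<n. u^3 * deviation Y \<sigma> k + r * deviation ((!) xs) \<sigma> k = 0"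
    define Ps where "Ps = map (\<lambda>i. (xs ! i, Y i)) [0..<n]"
    have Ps: "map fst Ps = xs" by (simp add: Ps_def n_def comp_def map_nth)
    have on: "\<forall>P\<in>set Ps. on_curve E P" using Y by (auto simp: Ps_def)
    \<comment> \<open>\<open>snd (Ps ! i)\<close> is known to be \<open>Y i\<close> only for
      \<open>i < n\<close>, which is enough since \<open>\<sigma>\<close> maps \<open>{..<n}\<close>
      to itself.\<close>
    have "deviation (\<lambda>i. snd (Ps ! i)) \<sigma> k = deviation Y \<sigma> k" if "k < n" for k
      using that
    proof (rule deviation_cong)
      fix j assume "j < n"
      then have "\<sigma> j < n" using permutes_in_image[OF \<sigma>, of j] by simp
      then show "snd (Ps ! \<sigma> j) = Y (\<sigma> j)" by (simp add: Ps_def)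
    qed
    with dev have e: "\<exists>e. arith_prog (map (\<lambda>i. snd (map (change_point u r s t) Ps ! \<sigma> i))
        [0..<length (map (change_point u r s t) Ps)]) e"
      by (subst y_prog[OF Ps \<sigma>]) simp
    have "simultaneous_arith_prog (change_curve u r s t E) (map (change_point u r s t) Ps)"
      unfolding simultaneous_arith_prog_def
    proof (intro conjI exI[of _ \<sigma>])
      show "\<forall>P\<in>set (map (change_point u r s t) Ps). on_curve (change_curve u r s t E) P"
        using on by (auto simp: on_curve_change_point[OF u])
      show "\<sigma> permutes {..<length (map (change_point u r s t) Ps)}"
        using \<sigma> by (simp add: Ps_def)
    qed (fact x_prog[OF Ps u] e)+
    with u Ps on show "sap_after_change E xs u r s t"
      unfolding sap_after_change_def by blast
  qed
qed

text \<open>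
  Taking \<open>u\<close> to be a nonvanishing deviation \<open>B j\<close> of the abscissae clears the denominator of the
  only possible value \<open>- A j / B j\<close> of \<open>r / u\<^sup>3\<close>.
\<close>

lemma scaling_exists_imp_candidate:
  fixes A B :: "nat \<Rightarrow> 'k::field"
  assumes "u \<noteq> 0" and eq: "\<And>k. k < n \<Longrightarrow> u^3 * A k + r * B k = 0"
  shows "(\<forall>k<n. A k = 0) \<or>
    (\<exists>j<n. B j \<noteq> 0 \<and> (\<forall>k<n. B j ^ 3 * A k + - (B j ^ 2 * A j) * B k = 0))"
proof (cases "\<exists>j<n. B j \<noteq> 0")
  case True
  then obtain j where j: "j < n" "B j \<noteq> 0" by blast
  have "B j ^ 3 * A k + - (B j ^ 2 * A j) * B k = 0" if "k < n" for k
  proof -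
    \<comment> \<open>Eliminating \<open>r\<close> between the equations for \<open>k\<close> and
      \<open>j\<close> leaves a multiple of \<open>u^3\<close>; the goal is the resulting relation
      multiplied by \<open>B j ^ 2\<close>.\<close>
    have "u^3 * (B j * A k - A j * B k)
        = B j * (u^3 * A k + r * B k) - B k * (u^3 * A j + r * B j)"
      by (simp add: algebra_simps)
    then have "B j * A k - A j * B k = 0"
      using eq[OF that] eq[OF j(1)] \<open>u \<noteq> 0\<close> by simp
    then show ?thesis by algebra
  qed
  with j show ?thesis by blast
next
  case False
  then show ?thesis using eq \<open>u \<noteq> 0\<close> by force
qed

lemma on_curve_conjugate:
  "on_curve E (x, y) \<Longrightarrow> on_curve E (x, - y - (a1 E * x + a3 E))"
  by (simp add: on_curve_def power2_eq_square algebra_simps)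

text \<open>For fixed \<open>x\<close> the equation is quadratic in \<open>y\<close> with root sum
  \<open>- (a1 E * x + a3 E)\<close>; the difference of its two instances factors
  accordingly.\<close>

lemma on_curve_cases:
  fixes E :: "'k::field weierstrass"
  assumes "on_curve E (x, y)" and "on_curve E (x, y')"
  shows "y' = y \<or> y' = - y - (a1 E * x + a3 E)"
proof -
  have "(y' - y) * (y' + y + (a1 E * x + a3 E))
      = (y'^2 + a1 E * x * y' + a3 E * y') - (y^2 + a1 E * x * y + a3 E * y)"
    by (simp add: power2_eq_square algebra_simps)
  also have "\<dots> = 0" using assms by (simp add: on_curve_def)
  finally have "y' - y = 0 \<or> y' + y + (a1 E * x + a3 E) = 0" by simp
  moreover have "y' = - y - z" if "y' + y + z = 0" for z using that by algebra
  ultimately show ?thesis by auto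
qed

section \<open>The algorithm\<close>

locale named_field =
  fixes \<nu> :: "nat \<Rightarrow> 'k::field" and add sub mul :: "nat \<Rightarrow> nat \<Rightarrow> nat" and zero one :: nat
  assumes add: "computable2 add" "\<nu> (add a b) = \<nu> a + \<nu> b"
    and sub: "computable2 sub" "\<nu> (sub a b) = \<nu> a - \<nu> b"
    and mul: "computable2 mul" "\<nu> (mul a b) = \<nu> a * \<nu> b"
    and equal: "computable2 (\<lambda>a b. of_bool (\<nu> a = \<nu> b))"
    and zero: "\<nu> zero = 0" and one: "\<nu> one = 1"
begin

lemmas name_simps = add(2) sub(2) mul(2) zero one

lemma decidable_equal:
  "computable f \<Longrightarrow> computable g \<Longrightarrow> decidable (\<lambda>x. \<nu> (f x) = \<nu> (g x))"
  unfolding decidable_def by (rule computable_compose2[OF equal])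

lemmas field_intros = computable_compose2[OF add(1)] computable_compose2[OF sub(1)]
  computable_compose2[OF mul(1)] decidable_equal computable_intros

section \<open>Names for multiples of one and for deviations\<close>

definition nat_name :: "nat \<Rightarrow> nat" where
  "nat_name k = rec_nat zero (\<lambda>_ c. add c one) k"

lemma nat_name: "\<nu> (nat_name k) = of_nat k"
  unfolding nat_name_def by (induction k) (simp_all add: name_simps add.commute)

lemma computable_nat_name: "computable k \<Longrightarrow> computable (\<lambda>x. nat_name (k x))"
  unfolding nat_name_def by (intro computable_rec_nat field_intros)

definition deviation_name :: "(nat \<Rightarrow> nat) \<Rightarrow> nat \<Rightarrow> nat \<Rightarrow> nat" where
  "deviation_name F q k = sub (sub (F (cnth q k)) (F (cnth q 0)))
     (mul (nat_name k) (sub (F (cnth q 1)) (F (cnth q 0))))"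

lemma deviation_name: "\<nu> (deviation_name F q k) = deviation (\<lambda>j. \<nu> (F j)) (cnth q) k"
  by (simp add: deviation_name_def deviation_def name_simps nat_name)

lemma computable_deviation_name:
  assumes "computable (\<lambda>z. F (pfst z) (psnd z))" and "computable q" and "computable k"
  shows "computable (\<lambda>x. deviation_name (F x) (q x) (k x))"
  unfolding deviation_name_def
  by (intro computable_compose2[OF computable_uncurried[of F, OF assms(1)]] computable_nat_name
      field_intros assms)

text \<open>
  Below, \<open>i\<close> is the code of an input (five coefficients, then the abscissae), \<open>w\<close> codes a list of
  ordinates, one above each abscissa, and \<open>q\<close> codes a candidate: with \<open>n\<close> abscissae, entries
  \<open>0..<n\<close> of \<open>q\<close> are the permutation, entries \<open>n..<2n\<close> select the ordinate of \<open>w\<close> or its conjugate,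
  and entry \<open>2n\<close> is \<open>0\<close> for \<open>(u, r) = (1, 0)\<close> or \<open>Suc j\<close> for \<open>(u, r) = (B j, - B j ^ 2 * A j)\<close>,
  where \<open>A\<close> and \<open>B\<close> are the deviations of the ordinates and of the abscissae.
\<close>

definition num_points :: "nat \<Rightarrow> nat" where "num_points i = clength i - 5"

definition abscissa :: "nat \<Rightarrow> nat \<Rightarrow> nat" where "abscissa i k = cnth i (k + 5)"

definition on_curve_names :: "nat \<Rightarrow> nat \<Rightarrow> nat \<Rightarrow> bool" where
  "on_curve_names i x y \<longleftrightarrow>
     \<nu> (add (add (mul y y) (mul (mul (cnth i 0) x) y)) (mul (cnth i 2) y)) =
     \<nu> (add (add (add (mul x (mul x x)) (mul (cnth i 1) (mul x x))) (mul (cnth i 3) x)) (cnth i 4))"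

definition all_on_curve :: "nat \<Rightarrow> nat \<Rightarrow> bool" where
  "all_on_curve i w \<longleftrightarrow> (\<forall>k<num_points i. on_curve_names i (abscissa i k) (cnth w k))"

definition ordinate :: "nat \<Rightarrow> nat \<Rightarrow> nat \<Rightarrow> nat \<Rightarrow> nat" where
  "ordinate i w q k = (if cnth q (num_points i + k) = 0 then cnth w k
     else sub (sub zero (cnth w k)) (add (mul (cnth i 0) (abscissa i k)) (cnth i 2)))"

definition candidate_u :: "nat \<Rightarrow> nat \<Rightarrow> nat" where
  "candidate_u i q = (if cnth q (num_points i + num_points i) = 0 then one
     else deviation_name (abscissa i) q (cnth q (num_points i + num_points i) - 1))"

definition candidate_r :: "nat \<Rightarrow> nat \<Rightarrow> nat \<Rightarrow> nat" where
  "candidate_r i w q = (if cnth q (num_points i + num_points i) = 0 then zero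
     else sub zero (mul (mul (candidate_u i q) (candidate_u i q))
       (deviation_name (ordinate i w q) q (cnth q (num_points i + num_points i) - 1))))"

text \<open>Bounded quantifiers over decidable atoms keep this decidable. Distinctness suffices for
  a permutation, since an injective self-map of a finite set is surjective.\<close>

definition valid_candidate :: "nat \<Rightarrow> nat \<Rightarrow> nat \<Rightarrow> bool" where
  "valid_candidate i w q \<longleftrightarrow>
     (\<forall>k<num_points i. cnth q k < num_points i) \<and>
     (\<forall>k<num_points i. \<forall>l<k. \<not> cnth q k = cnth q l) \<and>
     \<not> \<nu> (candidate_u i q) = \<nu> zero \<and>
     (\<forall>k<num_points i.
       \<nu> (add (mul (mul (candidate_u i q) (mul (candidate_u i q) (candidate_u i q)))
            (deviation_name (ordinate i w q) q k))
          (mul (candidate_r i w q) (deviation_name (abscissa i) q k))) = \<nu> zero)"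

text \<open>The code of the list of \<open>2n + 1\<close> entries all equal to \<open>n\<close>.
  Every candidate that has to be tried has this length and entries at most \<open>n\<close>, so its
  code is no larger.\<close>

definition candidate_bound :: "nat \<Rightarrow> nat" where
  "candidate_bound i = rec_nat 0 (\<lambda>_ c. Suc (prod_encode (num_points i, c)))
     (Suc (num_points i + num_points i))"

definition search_result :: "nat \<Rightarrow> nat \<Rightarrow> nat" where
  "search_result i w = bsearch (valid_candidate i w) (Suc (candidate_bound i))"

definition output_code :: "nat \<Rightarrow> nat \<Rightarrow> nat" where
  "output_code i w = (if search_result i w = 0 then list_encode []
     else list_encode [candidate_u i (search_result i w - 1),
       candidate_r i w (search_result i w - 1), zero, zero])"

section \<open>Computability of the search\<close>

lemma computable_num_points: "computable i \<Longrightarrow> computable (\<lambda>x. num_points (i x))"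
  unfolding num_points_def by (intro field_intros)

lemma computable_abscissa:
  "computable i \<Longrightarrow> computable k \<Longrightarrow> computable (\<lambda>x. abscissa (i x) (k x))"
  unfolding abscissa_def by (intro field_intros)

text \<open>\<open>Mu\<close> varies the first argument of its program, so the ordinates precede the
  input here.\<close>

lemma decidable_all_on_curve: "decidable (\<lambda>z. all_on_curve (psnd z) (pfst z))"
  unfolding all_on_curve_def on_curve_names_def
  by (intro field_intros computable_num_points computable_abscissa)

lemma computable_ordinate:
  assumes "computable i" "computable w" "computable q" "computable k"
  shows "computable (\<lambda>x. ordinate (i x) (w x) (q x) (k x))"
  unfolding ordinate_def by (intro field_intros computable_num_points computable_abscissa assms)

lemma computable_weaken: "computable f \<Longrightarrow> computable (\<lambda>z. f (pfst z))"
  by (rule computable_compose[OF _ computable_pfst[OF computable_id]])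

lemma computable_candidate_u:
  assumes "computable i" "computable q"
  shows "computable (\<lambda>x. candidate_u (i x) (q x))"
  unfolding candidate_u_def
  by (intro field_intros computable_num_points computable_deviation_name computable_abscissa
      assms assms(1)[THEN computable_weaken])

lemma computable_candidate_r:
  assumes "computable i" "computable w" "computable q"
  shows "computable (\<lambda>x. candidate_r (i x) (w x) (q x))"
  unfolding candidate_r_def
  by (intro field_intros computable_num_points computable_deviation_name computable_candidate_u
      computable_ordinate assms assms[THEN computable_weaken])

lemma decidable_valid_candidate:
  "decidable (\<lambda>z. valid_candidate (pfst (pfst z)) (psnd (pfst z)) (psnd z))"
  unfolding valid_candidate_def
  by (intro field_intros computable_num_points computable_deviation_name computable_candidate_u
      computable_candidate_r computable_ordinate computable_abscissa)

lemma computable2_output_code: "computable2 output_code"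
proof (rule computable_uncurried)
  have bound: "computable (\<lambda>z. candidate_bound (pfst z))"
    unfolding candidate_bound_def
    by (intro computable_rec_nat field_intros computable_num_points)
  show "computable (\<lambda>z. output_code (pfst z) (psnd z))"
    unfolding output_code_def search_result_def list_encode.simps
    by (intro field_intros decidable_valid_candidate bound computable_candidate_u computable_candidate_r)
qed

lemma list_encode_le_candidate_bound:
  assumes "length xs = Suc (num_points i + num_points i)" and "\<forall>x\<in>set xs. x \<le> num_points i"
  shows "list_encode xs \<le> candidate_bound i"
proof -
  have "rec_nat 0 (\<lambda>_ c. Suc (prod_encode (num_points i, c))) m
      = list_encode (replicate m (num_points i))" for m
    by (induction m) simp_all
  then show ?thesis
    unfolding candidate_bound_def
    using assms by (simp only:) (auto simp: list_all2_conv_all_nth intro!: list_encode_mono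
      simp del: replicate_Suc)
qed

section \<open>Correctness of the search on a given input\<close>

context
  fixes E :: "'k weierstrass" and xs :: "'k list" and input :: "nat list"
  assumes input: "map \<nu> input = [a1 E, a2 E, a3 E, a4 E, a6 E] @ xs"
begin

abbreviation "icode \<equiv> list_encode input"

lemma name_cnth_input:
  assumes "k < length xs + 5"
  shows "\<nu> (cnth icode k) = ([a1 E, a2 E, a3 E, a4 E, a6 E] @ xs) ! k"
proof -
  have "k < length input" using arg_cong[OF input, of length] assms by simp
  then show ?thesis unfolding input[symmetric] by (simp add: cnth_list_encode)
qed

lemma num_points_input [simp]: "num_points icode = length xs"
  using arg_cong[OF input, of length] by (simp add: num_points_def clength_list_encode)

lemma name_abscissa: "k < length xs \<Longrightarrow> \<nu> (abscissa icode k) = xs ! k"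
  by (simp add: abscissa_def name_cnth_input nth_append)

lemma name_coefficients:
  "\<nu> (cnth icode 0) = a1 E" "\<nu> (cnth icode 1) = a2 E" "\<nu> (cnth icode 2) = a3 E"
  "\<nu> (cnth icode 3) = a4 E" "\<nu> (cnth icode 4) = a6 E"
  by (subst name_cnth_input; simp)+

lemma on_curve_names_iff: "on_curve_names icode x y \<longleftrightarrow> on_curve E (\<nu> x, \<nu> y)"
  unfolding on_curve_names_def on_curve_def prod.case name_simps name_coefficients
  by (simp add: power2_eq_square power3_eq_cube mult.assoc)

lemma all_on_curve_iff: "all_on_curve icode w \<longleftrightarrow> (\<forall>k<length xs. on_curve E (xs ! k, \<nu> (cnth w k)))"
  by (simp add: all_on_curve_def on_curve_names_iff name_abscissa)

lemma name_ordinate: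
  "k < length xs \<Longrightarrow> \<nu> (ordinate icode w q k) =
    (if cnth q (length xs + k) = 0 then \<nu> (cnth w k)
     else - \<nu> (cnth w k) - (a1 E * xs ! k + a3 E))"
  by (simp add: ordinate_def name_simps name_coefficients name_abscissa)

lemma valid_candidate_sound:
  assumes ap: "x_arith_prog E xs" and w: "all_on_curve icode w" and q: "valid_candidate icode w q"
  shows "sap_after_change E xs (\<nu> (candidate_u icode q)) (\<nu> (candidate_r icode w q)) 0 0"
  unfolding sap_after_change_iff[OF ap]
proof (intro conjI exI)
  let ?n = "length xs" and ?Y = "\<lambda>j. \<nu> (ordinate icode w q j)"
  \<comment> \<open>\<open>permutes\<close> demands the identity outside \<open>{..<n}\<close>,
    where the entries of \<open>q\<close> have another meaning.\<close>
  define \<sigma> where "\<sigma> k = (if k < ?n then cnth q k else k)" for k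
  have less: "cnth q k < ?n" if "k < ?n" for k
    using q that by (simp add: valid_candidate_def)
  have inj: "cnth q k \<noteq> cnth q l" if "l < k" "k < ?n" for k l
    using q that by (simp add: valid_candidate_def)
  show "\<nu> (candidate_u icode q) \<noteq> 0"
    using q by (simp add: valid_candidate_def name_simps)
  show "\<forall>k<?n. on_curve E (xs ! k, ?Y k)"
    using w by (auto simp: all_on_curve_iff name_ordinate intro: on_curve_conjugate)
  show "\<sigma> permutes {..<?n}"
  proof (rule bij_imp_permutes)
    have "inj_on \<sigma> {..<?n}"
      by (rule linorder_inj_onI) (use inj in \<open>force simp: \<sigma>_def\<close>, auto)
    then show "bij_betw \<sigma> {..<?n} {..<?n}"
      by (intro bij_betw_imageI endo_inj_surj) (use less in \<open>auto simp: \<sigma>_def\<close>)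
  qed (simp add: \<sigma>_def)
  show "\<forall>k<?n. \<nu> (candidate_u icode q) ^ 3 * deviation ?Y \<sigma> k +
      \<nu> (candidate_r icode w q) * deviation ((!) xs) \<sigma> k = 0"
  proof (intro allI impI)
    fix k assume k: "k < ?n"
    have "deviation ?Y \<sigma> k = \<nu> (deviation_name (ordinate icode w q) q k)"
      unfolding deviation_name by (rule deviation_cong[OF k]) (simp add: \<sigma>_def)
    moreover have "deviation ((!) xs) \<sigma> k = \<nu> (deviation_name (abscissa icode) q k)"
      unfolding deviation_name
      by (rule deviation_cong[OF k]) (simp add: \<sigma>_def name_abscissa less)
    ultimately show "\<nu> (candidate_u icode q) ^ 3 * deviation ?Y \<sigma> k +
        \<nu> (candidate_r icode w q) * deviation ((!) xs) \<sigma> k = 0"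
      using q k by (simp add: valid_candidate_def name_simps power3_eq_cube mult.assoc)
  qed
qed

text \<open>The given \<open>(u, r)\<close> need not be among the candidates; its permutation and
  ordinates are encoded together with a scaling supplied by
  \<open>scaling_exists_imp_candidate\<close>.\<close>

lemma valid_candidate_complete:
  assumes ap: "x_arith_prog E xs" and w: "all_on_curve icode w"
    and sap: "sap_after_change E xs u r s t"
  shows "\<exists>q\<le>candidate_bound icode. valid_candidate icode w q"
proof -
  let ?n = "length xs"
  obtain Y \<sigma> where u: "u \<noteq> 0" and Y: "\<And>k. k < ?n \<Longrightarrow> on_curve E (xs ! k, Y k)"
    and \<sigma>: "\<sigma> permutes {..<?n}"
    and eq: "\<And>k. k < ?n \<Longrightarrow> u^3 * deviation Y \<sigma> k + r * deviation ((!) xs) \<sigma> k = 0"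
    using sap unfolding sap_after_change_iff[OF ap] by blast
  have n: "0 < ?n" using ap by (auto simp: x_arith_prog_def arith_prog_def)
  let ?A = "deviation Y \<sigma>" and ?B = "deviation ((!) xs) \<sigma>"
  \<comment> \<open>\<open>v m\<close> and \<open>p m\<close> are the values of \<open>u\<close> and
    \<open>r\<close> that a last entry \<open>m\<close> stands for.\<close>
  define v where "v m = (if m = 0 then 1 else ?B (m - 1))" for m :: nat
  define p where "p m = (if m = 0 then 0 else - (?B (m - 1) ^ 2 * ?A (m - 1)))" for m :: nat
  have "(\<forall>k<?n. ?A k = 0) \<or>
      (\<exists>j<?n. ?B j \<noteq> 0 \<and> (\<forall>k<?n. ?B j ^ 3 * ?A k + - (?B j ^ 2 * ?A j) * ?B k = 0))"
    by (rule scaling_exists_imp_candidate[OF u]) (rule eq)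
  then obtain m where m: "m \<le> ?n" "v m \<noteq> 0" "\<And>k. k < ?n \<Longrightarrow> v m ^ 3 * ?A k + p m * ?B k = 0"
  proof (elim disjE exE conjE)
    assume "\<forall>k<?n. ?A k = 0"
    then show thesis by (intro that[of 0]) (simp_all add: v_def p_def)
  next
    fix j assume "j < ?n" "?B j \<noteq> 0" "\<forall>k<?n. ?B j ^ 3 * ?A k + - (?B j ^ 2 * ?A j) * ?B k = 0"
    then show thesis by (intro that[of "Suc j"]) (simp_all add: v_def p_def)
  qed
  \<comment> \<open>Where \<open>Y k\<close> differs from the stored ordinate, it has to be the
    conjugate by \<open>on_curve_cases\<close>.\<close>
  define c where "c k = (of_bool (Y k \<noteq> \<nu> (cnth w k)) :: nat)" for k
  define qs where "qs = map \<sigma> [0..<?n] @ map c [0..<?n] @ [m]"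
  define q where "q = list_encode qs"
  have len: "length qs = Suc (?n + ?n)" by (simp add: qs_def)
  have \<sigma>_less: "\<sigma> k < ?n" if "k < ?n" for k using permutes_in_image[OF \<sigma>, of k] that by simp
  have q_\<sigma>: "cnth q k = \<sigma> k" if "k < ?n" for k
    unfolding q_def using that by (subst cnth_list_encode) (simp_all add: len, simp add: qs_def nth_append)
  have q_c: "cnth q (?n + k) = c k" if "k < ?n" for k
    unfolding q_def using that by (subst cnth_list_encode) (simp_all add: len, simp add: qs_def nth_append)
  have q_m: "cnth q (?n + ?n) = m"
    unfolding q_def by (subst cnth_list_encode) (simp_all add: len, simp add: qs_def nth_append)
  have ordinate: "\<nu> (ordinate icode w q k) = Y k" if "k < ?n" for k
    using that on_curve_cases[OF _ Y[OF that], of "\<nu> (cnth w k)"] w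
    by (auto simp: name_ordinate q_c c_def all_on_curve_iff)
  have A: "\<nu> (deviation_name (ordinate icode w q) q k) = ?A k" if "k < ?n" for k
    unfolding deviation_name
    by (rule deviation_cong[OF that]) (simp add: q_\<sigma> ordinate \<sigma>_less)
  have B: "\<nu> (deviation_name (abscissa icode) q k) = ?B k" if "k < ?n" for k
    unfolding deviation_name
    by (rule deviation_cong[OF that]) (simp add: q_\<sigma> name_abscissa \<sigma>_less)
  have cu: "\<nu> (candidate_u icode q) = v m"
    using B[of "m - 1"] m(1) by (auto simp: candidate_u_def q_m v_def name_simps)
  then have cr: "\<nu> (candidate_r icode w q) = p m"
    using A[of "m - 1"] m(1)
    by (auto simp: candidate_r_def q_m v_def p_def name_simps power2_eq_square)
  have "valid_candidate icode w q"
    unfolding valid_candidate_def num_points_input name_simps cu cr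
  proof (intro conjI allI impI)
    show "cnth q k < ?n" if "k < ?n" for k using that by (simp add: q_\<sigma> \<sigma>_less)
    show "cnth q k \<noteq> cnth q l" if "k < ?n" "l < k" for k l
      using that inj_eq[OF permutes_inj[OF \<sigma>], of k l] by (simp add: q_\<sigma>)
    show "v m \<noteq> 0" by (rule m(2))
    show "v m * (v m * v m) * \<nu> (deviation_name (ordinate icode w q) q k) +
        p m * \<nu> (deviation_name (abscissa icode) q k) = 0" if "k < ?n" for k
      using m(3)[OF that] that by (simp add: A B power3_eq_cube mult.assoc)
  qed
  moreover have "q \<le> candidate_bound icode"
    unfolding q_def
  proof (rule list_encode_le_candidate_bound)
    \<comment> \<open>An entry of \<open>c\<close> can be \<open>1\<close>, which stays within the
      bound because \<open>0 < n\<close>.\<close>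
    show "\<forall>x\<in>set qs. x \<le> num_points icode"
      using \<sigma>_less n m(1) by (auto simp: qs_def c_def intro: less_imp_le)
  qed (simp add: len)
  ultimately show ?thesis by blast
qed

text \<open>This makes the unbounded search for ordinates halt: each abscissa carries a point, and
  surjectivity gives its ordinate a name.\<close>

lemma all_on_curve_exists:
  assumes "surj \<nu>" and "x_arith_prog E xs"
  shows "\<exists>w. all_on_curve icode w"
proof -
  have "\<exists>y. on_curve E (xs ! k, \<nu> y)" if "k < length xs" for k
    using assms that unfolding x_arith_prog_def by (metis nth_mem surjD)
  then obtain y where y: "on_curve E (xs ! k, \<nu> (y k))" if "k < length xs" for k by metis
  then have "all_on_curve icode (list_encode (map y [0..<length xs]))"
    by (simp add: all_on_curve_iff cnth_list_encode)
  then show ?thesis ..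
qed

text \<open>The answer is right for whatever ordinates \<open>w\<close> the search delivers, since
  the candidates cover both choices above every abscissa.\<close>

lemma output_code_correct:
  assumes ap: "x_arith_prog E xs" and w: "all_on_curve icode w"
  shows "\<exists>out. output_code icode w = list_encode out \<and>
    (if has_sap E xs
     then \<exists>u r s t. map \<nu> out = [u, r, s, t] \<and> sap_after_change E xs u r s t
     else out = [])"
proof (cases "search_result icode w")
  case 0
  then have "\<not> has_sap E xs"
    using valid_candidate_complete[OF ap w]
    unfolding search_result_def bsearch_eq_0 has_sap_def less_Suc_eq_le by blast
  then show ?thesis using 0 by (intro exI[of _ "[]"]) (simp add: output_code_def)
next
  case (Suc q)
  then have "valid_candidate icode w q"
    unfolding search_result_def by (rule bsearch_eq_Suc)
  from valid_candidate_sound[OF ap w this]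
  have sap: "sap_after_change E xs (\<nu> (candidate_u icode q)) (\<nu> (candidate_r icode w q)) 0 0" .
  then have "has_sap E xs" unfolding has_sap_def by blast
  with sap Suc show ?thesis
    by (intro exI[of _ "[candidate_u icode q, candidate_r icode w q, zero, zero]"])
      (simp add: output_code_def name_simps)
qed

end

section \<open>Assembling the program\<close>

lemma sap_algorithm:
  assumes "surj \<nu>"
  shows "\<exists>alg. \<forall>(E :: 'k weierstrass) xs input.
    x_arith_prog E xs \<longrightarrow> map \<nu> input = [a1 E, a2 E, a3 E, a4 E, a6 E] @ xs \<longrightarrow>
    (\<exists>out. computes alg [list_encode input] (list_encode out) \<and>
       (if has_sap E xs
        then (\<exists>u r s t. map \<nu> out = [u, r, s, t] \<and> sap_after_change E xs u r s t)
        else out = []))"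
proof -
  \<comment> \<open>\<open>Mu\<close> looks for a zero, so the test is negated.\<close>
  have "computable2 (\<lambda>w i. of_bool (\<not> all_on_curve i w))"
    using decidable_not[OF decidable_all_on_curve] unfolding decidable_def
    by (rule computable_uncurried)
  then obtain check where check: "\<And>w i. computes check [w, i] (of_bool (\<not> all_on_curve i w))"
    unfolding computable2_def by blast
  obtain post where post: "\<And>i w. computes post [i, w] (output_code i w)"
    using computable2_output_code unfolding computable2_def by blast
  \<comment> \<open>\<open>computable_Least\<close> asks for a solution at every input, but a code
    that describes no progression on a curve may have none; hence halting is shown input by
    input.\<close>
  have search: "computes (Mu check) [i] (LEAST w. all_on_curve i w)" if "\<exists>w. all_on_curve i w" for i
  proof (rule computes.Mu)
    show "computes check [LEAST w. all_on_curve i w, i] 0"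
      using check[of "LEAST w. all_on_curve i w" i] LeastI_ex[OF that] by simp
    show "\<forall>w<LEAST w. all_on_curve i w. \<exists>k. computes check [w, i] (Suc k)"
    proof (intro allI impI)
      fix w assume "w < (LEAST w. all_on_curve i w)"
      then have "\<not> all_on_curve i w" by (rule not_less_Least)
      then show "\<exists>k. computes check [w, i] (Suc k)" using check[of w i] by auto
    qed
  qed
  show ?thesis
  proof (intro exI[of _ "Comp post [Proj 0, Mu check]"] allI impI)
    fix E :: "'k weierstrass" and xs input
    assume ap: "x_arith_prog E xs" and input: "map \<nu> input = [a1 E, a2 E, a3 E, a4 E, a6 E] @ xs"
    let ?i = "list_encode input" and ?w = "LEAST w. all_on_curve (list_encode input) w"
    note ex = all_on_curve_exists[OF input assms ap]
    have "computes (Comp post [Proj 0, Mu check]) [?i] (output_code ?i ?w)"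
      by (rule computes_Comp2[OF _ search[OF ex] post]) (simp add: computes_Proj)
    with output_code_correct[OF input ap LeastI_ex[OF ex]]
    show "\<exists>out. computes (Comp post [Proj 0, Mu check]) [?i] (list_encode out) \<and>
       (if has_sap E xs
        then (\<exists>u r s t. map \<nu> out = [u, r, s, t] \<and> sap_after_change E xs u r s t)
        else out = [])"
      by metis
  qed
qed

end

text \<open>A result name exists for each pair of arguments, so choice turns it into a function,
  which the same program computes.\<close>

lemma computable2_choose_names:
  assumes "\<exists>f. \<forall>a b. \<exists>c. computes f [a, b] c \<and> \<nu> c = F a b"
  obtains g where "computable2 g" and "\<And>a b. \<nu> (g a b) = F a b"
proof -
  obtain f where "\<forall>a b. \<exists>c. computes f [a, b] c \<and> \<nu> c = F a b" using assms by blast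
  then obtain g where "\<And>a b. computes f [a, b] (g a b) \<and> \<nu> (g a b) = F a b" by metis
  then show thesis using that unfolding computable2_def by blast
qed

theorem theorem1:
  fixes \<nu> :: "nat \<Rightarrow> 'k::field"
  assumes "effective_field \<nu>"
  shows "\<exists>alg. \<forall>(E :: 'k weierstrass) xs input.
    elliptic_curve E \<longrightarrow> x_arith_prog E xs \<longrightarrow>
    map \<nu> input = [a1 E, a2 E, a3 E, a4 E, a6 E] @ xs \<longrightarrow>
    (\<exists>out. computes alg [list_encode input] (list_encode out) \<and>
       (if has_sap E xs
        then (\<exists>u r s t. map \<nu> out = [u, r, s, t] \<and> sap_after_change E xs u r s t)
        else out = []))"
proof -
  note eff = assms[unfolded effective_field_def]
  have surj: "surj \<nu>" using eff by blast
  obtain add where add: "computable2 add" "\<And>a b. \<nu> (add a b) = \<nu> a + \<nu> b"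
    by (rule computable2_choose_names[of \<nu> "\<lambda>a b. \<nu> a + \<nu> b"]) (use eff in blast)+
  obtain sub where sub: "computable2 sub" "\<And>a b. \<nu> (sub a b) = \<nu> a - \<nu> b"
    by (rule computable2_choose_names[of \<nu> "\<lambda>a b. \<nu> a - \<nu> b"]) (use eff in blast)+
  obtain mul where mul: "computable2 mul" "\<And>a b. \<nu> (mul a b) = \<nu> a * \<nu> b"
    by (rule computable2_choose_names[of \<nu> "\<lambda>a b. \<nu> a * \<nu> b"]) (use eff in blast)+
  have equal: "computable2 (\<lambda>a b. of_bool (\<nu> a = \<nu> b))"
    unfolding computable2_def of_bool_def using eff by blast
  obtain zero one where "\<nu> zero = 0" "\<nu> one = 1" using surj by (metis surjD)
  with add sub mul equal interpret named_field \<nu> add sub mul zero one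
    by unfold_locales
  from sap_algorithm[OF surj] show ?thesis by meson
qed

end
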